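(* Let $\mathbf{L}$ be a complete residuated lattice, let $R,S$ be disjoint relation schemes, and let $\mathcal{D}_1$, $\mathcal{D}_2$, $\mathcal{D}_3$ be ranked data tables (RDTs) over $\mathbf{L}$ on $R$, $S$, and $R\cup S$, respectively. Let $\mathcal{E}_R,\mathcal{E}_S,\mathcal{E}_{R\cup S}$ be the extended active domains built from the values occurring in $\mathcal{D}_1,\mathcal{D}_2,\mathcal{D}_3$, and put $$E=(\mathcal{D}_2\bowtie\mathcal{E}_R)\Rightarrow^{\mathcal{E}_{R\cup S}}\mathcal{D}_3 .$$ Then for all $r\in\mathrm{Tupl}(R)$, $$\bigl(\mathcal{D}_1\div^{\mathcal{D}_3}_{\mathrm{gsdo}}\mathcal{D}_2\bigr)(r)=\bigl(\mathcal{D}_1\bowtie(E\div^{\mathcal{E}_R}\mathcal{E}_S)\bigr)(r).$$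
   Context: A complete residuated lattice is $\mathbf{L}=\langle L,\wedge,\vee,\otimes,\rightarrow,0,1\rangle$ where $\langle L,\wedge,\vee,0,1\rangle$ is a complete lattice with least element $0$ and greatest element $1$, $\langle L,\otimes,1\rangle$ is a commutative monoid, and $a\otimes b\le c$ iff $a\le b\rightarrow c$ for all $a,b,c\in L$. Each attribute $y$ has a type (set of values) $D_y$; a relation scheme is a finite set of attributes. $\mathrm{Tupl}(R)=\prod_{y\in R}D_y$; for $r\in\mathrm{Tupl}(R)$ and $S\subseteq R$, $r(S)\in\mathrm{Tupl}(S)$ is the restriction of $r$ to $S$. If $r\in\mathrm{Tupl}(R)$, $s\in\mathrm{Tupl}(S)$ agree on $R\cap S$, $rs$ denotes the tuple $r\cup s\in\mathrm{Tupl}(R\cup S)$. An RDT on $R$ is a map $\mathcal{D}:\mathrm{Tupl}(R)\to L$ with $\{r\mid\mathcal{D}(r)>0\}$ finite. Natural join of $\mathcal{D}$ on $R$ and $\mathcal{D}'$ on $S$: the RDT on $R\cup S$ with $(\mathcal{D}\bowtie\mathcal{D}')(t)=\mathcal{D}(t(R))\otimes\mathcal{D}'(t(S))$. Residuum with range: for $\mathcal{A},\mathcal{B},\mathcal{C}$ on the same scheme, $(\mathcal{A}\Rightarrow^{\mathcal{C}}\mathcal{B})(t)=\mathcal{C}(t)\otimes(\mathcal{A}(t)\rightarrow\mathcal{B}(t))$. Division with range: for $\mathcal{A}$ on $R\cup S$, $\mathcal{B}$ on $S$, $\mathcal{C}$ on $R$ ($R\cap S=\emptyset$), $(\mathcal{A}\div^{\mathcal{C}}\mathcal{B})(r)=\bigwedge_{s\in\mathrm{Tupl}(S)}\bigl(\mathcal{C}(r)\otimes(\mathcal{B}(s)\rightarrow\mathcal{A}(rs))\bigr)$.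 Graded (original) Small Divide: for $\mathcal{A}$ on $R$, $\mathcal{B}$ on $S$, $\mathcal{C}$ on $R\cup S$ ($R\cap S=\emptyset$), $(\mathcal{A}\div^{\mathcal{C}}_{\mathrm{gsdo}}\mathcal{B})(r)=\mathcal{A}(r)\otimes\bigwedge_{s\in\mathrm{Tupl}(S)}\bigl(\mathcal{B}(s)\rightarrow\mathcal{C}(rs)\bigr)$. Extended active domains: for an attribute $y$, let $A_y$ be the (finite) set of all values $t(y)$ where $t$ is a tuple with non-zero score in one of the given tables $\mathcal{D}_1,\mathcal{D}_2,\mathcal{D}_3$ whose scheme contains $y$. For a scheme $Q$, $\mathcal{E}_Q$ is the RDT on $Q$ with $\mathcal{E}_Q(t)=1$ if $t(y)\in A_y$ for all $y\in Q$, and $\mathcal{E}_Q(t)=0$ otherwise. *)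

theory Defs
  imports Main "HOL-Library.FuncSet"
begin

class complete_residuated_lattice = complete_lattice +
  fixes otimes :: "'a \<Rightarrow> 'a \<Rightarrow> 'a"  (infixl "\<otimes>" 70)
    and residuum :: "'a \<Rightarrow> 'a \<Rightarrow> 'a"  (infixr "\<rightarrow>" 60)
  assumes otimes_assoc: "(a \<otimes> b) \<otimes> c = a \<otimes> (b \<otimes> c)"
    and otimes_commute: "a \<otimes> b = b \<otimes> a"
    and otimes_top: "a \<otimes> top = a"
    and adjointness: "a \<otimes> b \<le> c \<longleftrightarrow> a \<le> b \<rightarrow> c"

(* Dom y is the type (set of values) of the attribute y; the types of all
   attributes are subsets of one universe 'v.  A tuple is the constant
   undefined outside its scheme, so a tuple over Q is determined by its
   values on Q. *)
definition Tupl :: "('y \<Rightarrow> 'v set) \<Rightarrow> 'y set \<Rightarrow> ('y \<Rightarrow> 'v) set" where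
  "Tupl Dom Q = (\<Pi>\<^sub>E y\<in>Q. Dom y)"

(* The union of the tuples r over R and s over S.  It is only used for
   disjoint R and S, where the priority given to r is immaterial. *)
definition tuple_union :: "'y set \<Rightarrow> 'y set \<Rightarrow> ('y \<Rightarrow> 'v) \<Rightarrow> ('y \<Rightarrow> 'v) \<Rightarrow> ('y \<Rightarrow> 'v)" where
  "tuple_union R S r s = (\<lambda>y\<in>R \<union> S. if y \<in> R then r y else s y)"

(* Only the values of a table on the tuples over its scheme are meaningful. *)
type_synonym ('y, 'v, 'l) rdt = "('y \<Rightarrow> 'v) \<Rightarrow> 'l"

definition is_rdt ::
  "('y \<Rightarrow> 'v set) \<Rightarrow> 'y set \<Rightarrow> ('y, 'v, 'l::complete_residuated_lattice) rdt \<Rightarrow> bool" where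
  "is_rdt Dom Q A \<longleftrightarrow> finite {t \<in> Tupl Dom Q. A t > bot}"

(* The join of A over R with B over S. *)
definition natural_join ::
  "'y set \<Rightarrow> 'y set \<Rightarrow> ('y, 'v, 'l::complete_residuated_lattice) rdt
    \<Rightarrow> ('y, 'v, 'l) rdt \<Rightarrow> ('y, 'v, 'l) rdt" where
  "natural_join R S A B = (\<lambda>t. A (restrict t R) \<otimes> B (restrict t S))"

(* The residuum of A and B with range C. *)
definition residuum_range ::
  "('y, 'v, 'l::complete_residuated_lattice) rdt \<Rightarrow> ('y, 'v, 'l) rdt
    \<Rightarrow> ('y, 'v, 'l) rdt \<Rightarrow> ('y, 'v, 'l) rdt" where
  "residuum_range C A B = (\<lambda>t. C t \<otimes> (A t \<rightarrow> B t))"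

(* Division of A over R \<union> S by B over S with range C over R, for disjoint R and S. *)
definition division_range ::
  "('y \<Rightarrow> 'v set) \<Rightarrow> 'y set \<Rightarrow> 'y set \<Rightarrow> ('y, 'v, 'l::complete_residuated_lattice) rdt
    \<Rightarrow> ('y, 'v, 'l) rdt \<Rightarrow> ('y, 'v, 'l) rdt \<Rightarrow> ('y, 'v, 'l) rdt" where
  "division_range Dom R S C A B =
    (\<lambda>r. INF s\<in>Tupl Dom S. C r \<otimes> (B s \<rightarrow> A (tuple_union R S r s)))"

(* Graded Small Divide of A over R by B over S with mediator C over R \<union> S,
   for disjoint R and S. *)
definition small_divide ::
  "('y \<Rightarrow> 'v set) \<Rightarrow> 'y set \<Rightarrow> 'y set \<Rightarrow> ('y, 'v, 'l::complete_residuated_lattice) rdt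
    \<Rightarrow> ('y, 'v, 'l) rdt \<Rightarrow> ('y, 'v, 'l) rdt \<Rightarrow> ('y, 'v, 'l) rdt" where
  "small_divide Dom R S C A B =
    (\<lambda>r. A r \<otimes> (INF s\<in>Tupl Dom S. B s \<rightarrow> C (tuple_union R S r s)))"

(* \<T> is the collection of given tables, each paired with its scheme. *)
definition active_values ::
  "('y \<Rightarrow> 'v set) \<Rightarrow> ('y set \<times> ('y, 'v, 'l::complete_residuated_lattice) rdt) set
    \<Rightarrow> 'y \<Rightarrow> 'v set" where
  "active_values Dom \<T> y =
    {t y | t Q A. (Q, A) \<in> \<T> \<and> y \<in> Q \<and> t \<in> Tupl Dom Q \<and> A t \<noteq> bot}"

definition ext_active_domain ::
  "('y \<Rightarrow> 'v set) \<Rightarrow> ('y set \<times> ('y, 'v, 'l::complete_residuated_lattice) rdt) set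
    \<Rightarrow> 'y set \<Rightarrow> ('y, 'v, 'l) rdt" where
  "ext_active_domain Dom \<T> Q =
    (\<lambda>t. if \<forall>y\<in>Q. t y \<in> active_values Dom \<T> y then top else bot)"

end

theory Submission
  imports Defs
begin

text \<open>
  Where \<open>D1 r\<close> is \<open>0\<close> both sides vanish.  Otherwise all values of \<open>r\<close> are active, so the range
  \<open>\<E> R\<close> contributes \<open>1\<close>, and the two infima agree term by term: if all values of \<open>s\<close> are active,
  every active-domain factor is \<open>1\<close>; if not, then \<open>D2 s\<close> and \<open>\<E> S s\<close> are both \<open>0\<close> and both
  residua are \<open>1\<close>.
\<close>

lemma top_otimes: "top \<otimes> a = (a :: 'l::complete_residuated_lattice)"
  by (simp add: otimes_commute[of top] otimes_top)

lemma bot_otimes: "bot \<otimes> a = (bot :: 'l::complete_residuated_lattice)"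
  using adjointness[of bot a bot] by (simp add: bot_unique)

lemma bot_residuum: "bot \<rightarrow> a = (top :: 'l::complete_residuated_lattice)"
  using adjointness[of top bot a] by (simp add: top_otimes top_unique)

text \<open>By adjointness and neutrality of \<open>top\<close>, both sides have the same lower
  bounds.\<close>

lemma top_residuum: "top \<rightarrow> a = (a :: 'l::complete_residuated_lattice)"
  by (metis adjointness order.antisym order.refl otimes_top)

lemma restrict_Tupl: "t \<in> Tupl Dom Q \<Longrightarrow> restrict t Q = t"
  by (simp add: Tupl_def PiE_restrict)

lemma restrict_tuple_union_left:
  "r \<in> Tupl Dom R \<Longrightarrow> restrict (tuple_union R S r s) R = r"
  by (auto simp: fun_eq_iff tuple_union_def restrict_def Tupl_def PiE_def extensional_def)

lemma restrict_tuple_union_right: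
  "R \<inter> S = {} \<Longrightarrow> s \<in> Tupl Dom S \<Longrightarrow> restrict (tuple_union R S r s) S = s"
  by (auto simp: fun_eq_iff tuple_union_def restrict_def Tupl_def PiE_def extensional_def)

lemma ext_active_domain_eq_top:
  assumes "(Q, A) \<in> \<T>" and "t \<in> Tupl Dom Q" and "A t \<noteq> bot"
  shows "ext_active_domain Dom \<T> Q t = top"
  using assms unfolding ext_active_domain_def active_values_def by auto

text \<open>The values of \<open>r\<close> pass the test by assumption, and by disjointness the
  union agrees with \<open>s\<close> on \<open>S\<close>, so only \<open>s\<close> decides.\<close>

lemma ext_active_domain_tuple_union:
  assumes "R \<inter> S = {}"
    and "\<forall>y\<in>R. r y \<in> active_values Dom \<T> y"
  shows "ext_active_domain Dom \<T> (R \<union> S) (tuple_union R S r s) = ext_active_domain Dom \<T> S s"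
  using assms unfolding ext_active_domain_def tuple_union_def by (auto 4 4)

theorem theorem11:
  fixes Dom :: "'y \<Rightarrow> 'v set"
    and R S :: "'y set"
    and D1 D2 D3 :: "('y, 'v, 'l::complete_residuated_lattice) rdt"
    and \<E> :: "'y set \<Rightarrow> ('y, 'v, 'l) rdt"
    and E :: "('y, 'v, 'l) rdt"
  assumes "finite R" and "finite S" and "R \<inter> S = {}"
    and "is_rdt Dom R D1" and "is_rdt Dom S D2" and "is_rdt Dom (R \<union> S) D3"
    and "\<E> = ext_active_domain Dom {(R, D1), (S, D2), (R \<union> S, D3)}"
    and "E = residuum_range (\<E> (R \<union> S)) (natural_join S R D2 (\<E> R)) D3"
  shows "\<forall>r\<in>Tupl Dom R.
    small_divide Dom R S D3 D1 D2 r =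
    natural_join R R D1 (division_range Dom R S (\<E> R) E (\<E> S)) r"
proof
  fix r
  assume r: "r \<in> Tupl Dom R"
  show "small_divide Dom R S D3 D1 D2 r =
    natural_join R R D1 (division_range Dom R S (\<E> R) E (\<E> S)) r"
  proof (cases "D1 r = bot")
    case True
    then show ?thesis
      by (simp add: small_divide_def natural_join_def restrict_Tupl[OF r] bot_otimes)
  next
    case False
    let ?\<T> = "{(R, D1), (S, D2), (R \<union> S, D3)}"
    \<comment> \<open>The tuple \<open>r\<close> is its own witness, having nonzero score in
      \<open>D1\<close>.\<close>
    have active: "\<forall>y\<in>R. r y \<in> active_values Dom ?\<T> y"
      using r False unfolding active_values_def by auto
    have ER: "\<E> R r = top"
      using active by (simp add: assms(7) ext_active_domain_def)
    have "(D2 s \<rightarrow> D3 (tuple_union R S r s)) =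
        \<E> R r \<otimes> (\<E> S s \<rightarrow> E (tuple_union R S r s))" if s: "s \<in> Tupl Dom S" for s
    proof -
      \<comment> \<open>The joined factor \<open>\<E> R r\<close> is \<open>top\<close>, so the
        antecedent reduces to \<open>D2 s\<close>; the range on \<open>R \<union> S\<close> reduces
        to \<open>\<E> S s\<close>.\<close>
      have E: "E (tuple_union R S r s) = \<E> S s \<otimes> (D2 s \<rightarrow> D3 (tuple_union R S r s))"
        using assms(7,8) ER ext_active_domain_tuple_union[OF assms(3) active]
        by (simp add: residuum_range_def natural_join_def otimes_top
            restrict_tuple_union_left[OF r] restrict_tuple_union_right[OF assms(3) s])
      show ?thesis
      proof (cases "\<E> S s = top")
        case True
        then show ?thesis by (simp add: E ER top_otimes top_residuum)
      next
        case False
        then have "\<E> S s = bot"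
          unfolding assms(7) ext_active_domain_def by presburger
        \<comment> \<open>Contrapositive: a nonzero score in \<open>D2\<close> would make all values
          of \<open>s\<close> active.\<close>
        moreover have "D2 s = bot"
          using False s assms(7) ext_active_domain_eq_top[of S D2 ?\<T> s Dom] by blast
        ultimately show ?thesis by (simp add: ER bot_residuum otimes_top)
      qed
    qed
    \<comment> \<open>\<open>D1 r\<close> stands outside the infimum on both sides and
      \<open>\<E> R r\<close> inside it, so equality of the terms suffices.\<close>
    then show ?thesis
      by (simp add: small_divide_def natural_join_def division_range_def restrict_Tupl[OF r]
          cong: INF_cong)
  qed
qed

end
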